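(* Let $\mathcal{G}$ be a finite graph (i.e. a graph with finitely many vertices). If $\mathcal{G}$ is rotarily transitive, then $\mathcal{G}$ has exactly $1$ vertex.
   Context: A graph is a pair $\mathcal{G}=(V,E)$ where $V$ is a set (of vertices) and $E$ (the edges) is a set of subsets of $V$ having exactly two elements. An automorphism of $\mathcal{G}$ is a bijection $\varphi:V\to V$ such that for all $u,v\in V$, $\{u,v\}\in E \iff \{\varphi(u),\varphi(v)\}\in E$; these form the group $\mathrm{Aut}(\mathcal{G})$. A group $G$ acting on the graph $\mathcal{G}$ means a group morphism $G\to \mathrm{Aut}(\mathcal{G})$, i.e. a left action of $G$ on $V$ by graph automorphisms. A group action of $G$ on a set $X$ is transitive if for all $x,y\in X$ there is $g\in G$ with $g\cdot x=y$. It is by rotations if every $g\in G$ (including the identity) has at least one fixed point in $X$ (so in particular $X\neq\varnothing$). It is rotarily transitive if it is both transitive and by rotations. A graph is rotarily transitive if there exist a group $G$ and a rotarily transitive action of $G$ on its vertex set by graph automorphisms. *)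

theory Defs
  imports "HOL-Algebra.Group_Action"
begin

definition graph :: "'v set \<Rightarrow> 'v set set \<Rightarrow> bool" where
  "graph V E \<longleftrightarrow> (\<forall>e\<in>E. e \<subseteq> V \<and> card e = 2)"

text \<open>As everywhere in HOL-Algebra, a bijection of a set \<open>V\<close> is an element of \<open>Bij V\<close>: a
  function that restricts to a bijection of \<open>V\<close> and is \<open>undefined\<close> outside \<open>V\<close>.\<close>

definition graph_automorphisms :: "'v set \<Rightarrow> 'v set set \<Rightarrow> ('v \<Rightarrow> 'v) set" where
  "graph_automorphisms V E =
     {\<phi> \<in> Bij V. \<forall>u\<in>V. \<forall>v\<in>V. {u, v} \<in> E \<longleftrightarrow> {\<phi> u, \<phi> v} \<in> E}"

definition Aut_graph :: "'v set \<Rightarrow> 'v set set \<Rightarrow> ('v \<Rightarrow> 'v) monoid" where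
  "Aut_graph V E = (BijGroup V)\<lparr>carrier := graph_automorphisms V E\<rparr>"

lemma subgroup_graph_automorphisms:
  "subgroup (graph_automorphisms V E) (BijGroup V)"
proof (rule group.subgroupI[OF group_BijGroup])
  show "graph_automorphisms V E \<subseteq> carrier (BijGroup V)"
    by (auto simp: graph_automorphisms_def BijGroup_def)
  have "(\<lambda>x\<in>V. x) \<in> graph_automorphisms V E"
    by (simp add: graph_automorphisms_def id_Bij)
  then show "graph_automorphisms V E \<noteq> {}" by blast
next
  fix f assume f: "f \<in> graph_automorphisms V E"
  then have fB: "f \<in> Bij V" by (simp add: graph_automorphisms_def)
  have mem: "inv_into V f x \<in> V" if "x \<in> V" for x
    using Bij_inv_into_mem[OF fB that] .
  have inv: "f (inv_into V f x) = x" if "x \<in> V" for x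
    using fB that by (auto simp: Bij_def intro: bij_betw_inv_into_right)
  have "{u, v} \<in> E \<longleftrightarrow> {inv_into V f u, inv_into V f v} \<in> E" if "u \<in> V" "v \<in> V" for u v
    using f mem[OF that(1)] mem[OF that(2)] inv[OF that(1)] inv[OF that(2)]
    by (simp add: graph_automorphisms_def)
  then show "inv\<^bsub>BijGroup V\<^esub> f \<in> graph_automorphisms V E"
    by (simp add: inv_BijGroup[OF fB] graph_automorphisms_def restrict_inv_into_Bij[OF fB])
next
  fix f g assume f: "f \<in> graph_automorphisms V E" and g: "g \<in> graph_automorphisms V E"
  then have B: "f \<in> Bij V" "g \<in> Bij V" by (simp_all add: graph_automorphisms_def)
  have "g x \<in> V" if "x \<in> V" for x
    using Bij_imp_funcset[OF B(2)] that by auto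
  then show "f \<otimes>\<^bsub>BijGroup V\<^esub> g \<in> graph_automorphisms V E"
    using f g B by (simp add: BijGroup_def graph_automorphisms_def compose_Bij compose_eq)
qed

lemma group_Aut_graph: "group (Aut_graph V E)"
  unfolding Aut_graph_def
  by (rule subgroup.subgroup_is_group[OF subgroup_graph_automorphisms group_BijGroup])

definition graph_action ::
    "('g, 'b) monoid_scheme \<Rightarrow> 'v set \<Rightarrow> 'v set set \<Rightarrow> ('g \<Rightarrow> 'v \<Rightarrow> 'v) \<Rightarrow> bool" where
  "graph_action G V E \<phi> \<longleftrightarrow> group G \<and> \<phi> \<in> hom G (Aut_graph V E)"

lemma graph_action_imp_group_action:
  assumes "graph_action G V E \<phi>"
  shows "group_action G V \<phi>"
proof -
  have "\<phi> \<in> hom G (BijGroup V)"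
    using assms subgroup.subset[OF subgroup_graph_automorphisms]
    by (fastforce simp: graph_action_def Aut_graph_def hom_def)
  then show ?thesis
    using assms group_BijGroup
    by (simp add: group_action_def group_hom_def group_hom_axioms_def graph_action_def)
qed

definition by_rotations ::
    "('g, 'b) monoid_scheme \<Rightarrow> 'x set \<Rightarrow> ('g \<Rightarrow> 'x \<Rightarrow> 'x) \<Rightarrow> bool" where
  "by_rotations G X \<phi> \<longleftrightarrow> (\<forall>g\<in>carrier G. \<exists>x\<in>X. \<phi> g x = x)"

definition rotarily_transitive_action ::
    "('g, 'b) monoid_scheme \<Rightarrow> 'x set \<Rightarrow> ('g \<Rightarrow> 'x \<Rightarrow> 'x) \<Rightarrow> bool" where
  "rotarily_transitive_action G X \<phi> \<longleftrightarrow> transitive_action G X \<phi> \<and> by_rotations G X \<phi>"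

text \<open>HOL cannot quantify over types inside a formula, so the existential quantifier over
  groups ranges over the groups with elements in a type \<open>'g\<close> that is passed as an argument.
  A hypothesis \<open>rotarily_transitive_graph TYPE('g) V E\<close> with \<open>'g\<close> arbitrary covers all groups.\<close>

definition rotarily_transitive_graph :: "'g itself \<Rightarrow> 'v set \<Rightarrow> 'v set set \<Rightarrow> bool" where
  "rotarily_transitive_graph _ V E \<longleftrightarrow>
     (\<exists>(G :: 'g monoid) \<phi>. graph_action G V E \<phi> \<and> rotarily_transitive_action G V \<phi>)"

end

theory Submission
  imports Defs
begin

text \<open>This is Jordan's theorem that a transitive permutation group on a finite set with more than
  one point contains a derangement. By Burnside's lemma, the number of fixed points of an element
  of a finite transitive group is \<open>1\<close> on average; if every element has a fixed point, then every
  element has exactly one, and the identity fixes everything. The acting group may be infinite,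
  but it can be replaced by its image in the finite symmetric group.\<close>

lemma finite_Bij:
  assumes "finite S"
  shows "finite (Bij S)"
proof (rule finite_subset)
  \<comment> \<open>Members of \<open>Bij S\<close> are \<open>undefined\<close> off
    \<open>S\<close>, so their values on \<open>S\<close> determine them.\<close>
  show "Bij S \<subseteq> S \<rightarrow>\<^sub>E S"
    by (auto simp: Bij_def PiE_def bij_betw_apply)
  show "finite (S \<rightarrow>\<^sub>E S)"
    using assms by (simp add: finite_PiE)
qed

lemma (in transitive_action) orbits_eq_singleton:
  assumes "E \<noteq> {}"
  shows "orbits G E \<phi> = {E}"
proof -
  have "orbit G \<phi> x = E" if "x \<in> E" for x
    using that unique_orbit[of x] element_image by (fastforce simp: orbit_def)
  then show ?thesis
    using assms by (auto simp: orbits_def)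
qed

lemma rotarily_transitive_action_finite_group:
  assumes rot: "rotarily_transitive_action G X \<phi>"
    and finG: "finite (carrier G)" and finX: "finite X"
  shows "card X = 1"
proof -
  interpret transitive_action G X \<phi>
    using rot by (simp add: rotarily_transitive_action_def)
  interpret group_hom G "BijGroup X" \<phi>
    by (rule group_hom)
  have fixpt: "invariants X \<phi> g \<noteq> {}" if "g \<in> carrier G" for g
    using rot that by (auto simp: rotarily_transitive_action_def by_rotations_def invariants_def)
  have inv_one: "invariants X \<phi> \<one>\<^bsub>G\<^esub> = X"
    by (auto simp: invariants_def BijGroup_def)
  \<comment> \<open>The identity has a fixed point too, which rules out the empty set, where there
    would be no orbit to count.\<close>
  then have "X \<noteq> {}"
    using fixpt[of "\<one>\<^bsub>G\<^esub>"] by simp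
  have ge1: "1 \<le> card (invariants X \<phi> g)" if "g \<in> carrier G" for g
    using fixpt[OF that] finX by (simp add: Suc_le_eq card_gt_0_iff invariants_def)
  have "(\<Sum>g\<in>carrier G. 1) = (\<Sum>g\<in>carrier G. card (invariants X \<phi> g))"
    using burnside[OF finG finX] orbits_eq_singleton[OF \<open>X \<noteq> {}\<close>] by (simp add: order_def)
  \<comment> \<open>Equal sums with termwise \<le> force equality in every term, here in the one for
    the identity.\<close>
  then have "1 = card (invariants X \<phi> \<one>\<^bsub>G\<^esub>)"
    by (rule sum_mono_inv[OF _ ge1 _ finG]) simp_all
  then show ?thesis
    by (simp add: inv_one)
qed

text \<open>The image consists of the same permutations of \<open>X\<close>, so orbits and fixed
  points do not change; the action becomes the inclusion \<open>id\<close>.\<close>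

lemma rotarily_transitive_action_image:
  assumes "rotarily_transitive_action G X \<phi>"
  shows "rotarily_transitive_action ((BijGroup X)\<lparr>carrier := \<phi> ` carrier G\<rparr>) X id"
proof -
  interpret transitive_action G X \<phi>
    using assms by (simp add: rotarily_transitive_action_def)
  interpret group_hom G "BijGroup X" \<phi>
    by (rule group_hom)
  have "transitive_action ((BijGroup X)\<lparr>carrier := \<phi> ` carrier G\<rparr>) X id"
  proof (intro transitive_action.intro group_action.intro transitive_action_axioms.intro)
    show "group_hom ((BijGroup X)\<lparr>carrier := \<phi> ` carrier G\<rparr>) (BijGroup X) id"
      by (rule group.canonical_inj_is_hom[OF group_BijGroup img_is_subgroup])
  qed (use unique_orbit in simp)
  then show ?thesis
    using assms by (simp add: rotarily_transitive_action_def by_rotations_def)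
qed

theorem proposition1p1:
  fixes V :: "'v set" and E :: "'v set set"
  assumes "graph V E" and "finite V"
    and "rotarily_transitive_graph TYPE('g) V E"
  shows "card V = 1"
proof -
  obtain G :: "'g monoid" and \<phi> where rot: "rotarily_transitive_action G V \<phi>"
    using assms(3) by (auto simp: rotarily_transitive_graph_def)
  then interpret transitive_action G V \<phi>
    by (simp add: rotarily_transitive_action_def)
  \<comment> \<open>\<open>G\<close> itself may be infinite, but its image lies in the finite set
    \<open>Bij V\<close>.\<close>
  have "finite (\<phi> ` carrier G)"
    using finite_subset[OF _ finite_Bij[OF assms(2)]] bij_prop0 by blast
  then show ?thesis
    using rotarily_transitive_action_finite_group[OF rotarily_transitive_action_image[OF rot]]
      assms(2) by simp
qed

end
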